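(* Let $\mathfrak g$ be a complex simple Lie algebra with real form $\mathfrak g^{\mathbf R}$ and complexified Cartan decomposition $\mathfrak g=\mathfrak h\oplus\mathfrak m$. An $\mathfrak{sl}_2$-triple $\hat\rho:\mathfrak{sl}_2\mathbf R\to\mathfrak g^{\mathbf R}$ with Cayley transform $\rho$ is an extended magical triple if and only if $\mathfrak c\subset\mathfrak h$ and $$\dim\mathfrak m-\dim\mathfrak h=\dim\mathfrak g_0-2\dim\mathfrak c.$$ In particular, if $\hat\rho$ is extended magical, then $\mathfrak c^{\mathbf R}:=\mathfrak c\cap\mathfrak g^{\mathbf R}$ is contained in $\mathfrak h^{\mathbf R}$ and is compact, i.e. the Killing form restricted to $\mathfrak c^{\mathbf R}$ is negative definite.
   Context: $\mathfrak g^{\mathbf R}=\mathfrak h^{\mathbf R}\oplus\mathfrak m^{\mathbf R}$ is a Cartan decomposition with complexification $\mathfrak g=\mathfrak h\oplus\mathfrak m$ and $\sigma$ the involution equal to $+1$ on $\mathfrak h$, $-1$ on $\mathfrak m$. A complex $\mathfrak{sl}_2$-triple $\rho$ has image spanned by $e,h,f$ with $[h,e]=2e,[h,f]=-2f,[e,f]=h$; $\mathfrak g_j$ is the $j$-eigenspace of $\mathrm{ad}_h$; $\mathfrak g=\bigoplus_jW_j$ with $W_j$ the isotypic component of the $(j+1)$-dimensional irreducible $\mathfrak{sl}_2$-representation, $V_j=W_j\cap\ker\mathrm{ad}_e$, $W_j=\bigoplus_{k=0}^j(\mathrm{ad}_f)^kV_j$, and $\mathfrak c=V_0$ is the centralizer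 of $\{e,h,f\}$. The magical linear map is $\sigma^{\mathrm{mag}}_\rho=\mathrm{id}$ on $V_0$ and $(-1)^{k+1}$ on $(\mathrm{ad}_f)^kV_j$, $j>0$. $\rho$ is extended magical if some Lie algebra involution $\sigma_\rho$ of $\mathfrak g$ agrees with $\sigma^{\mathrm{mag}}_\rho$ on $\bigoplus_{j\text{ even}}W_j$; the canonical real form is the real form whose complexified Cartan involution is $\sigma_\rho$. A real triple $\hat\rho$ (with image $\hat e,\hat h,\hat f$, normalized to be a Cayley triple: $\sigma(\hat e)=-\hat f,\sigma(\hat h)=-\hat h$) has Cayley transform the normal triple $h=i(\hat e-\hat f)$, $e=\frac12(\hat e+\hat f+i\hat h)$, $f=\frac12(\hat e+\hat f-i\hat h)$ (so $\sigma(e)=-e,\sigma(h)=h,\sigma(f)=-f$). $\hat\rho$ is extended magical if $\rho$ is extended magical with canonical real form $\mathfrak g^{\mathbf R}$ (equivalently, $\sigma$ is $+1$ on $\mathfrak c$ and $-1$ on $\bigoplus_{j>0}V_{2j}$). *)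

theory Defs
  imports "HOL-Analysis.Analysis"
begin

text \<open>The complex Lie algebra g is modelled on the complex vector space complex^'n
  (every finite-dimensional complex vector space is isomorphic to one of these);
  the Lie bracket is an arbitrary map br.  Complex linear algebra uses the
  library interpretation vec (scalar multiplication *s).\<close>

type_synonym 'n cvec = "complex ^ 'n"

definition lie_algebra :: "('n::finite cvec \<Rightarrow> 'n cvec \<Rightarrow> 'n cvec) \<Rightarrow> bool" where
  "lie_algebra br \<longleftrightarrow>
     (\<forall>x. Vector_Spaces.linear (*s) (*s) (br x)) \<and>
     (\<forall>y. Vector_Spaces.linear (*s) (*s) (\<lambda>x. br x y)) \<and>
     (\<forall>x. br x x = 0) \<and>
     (\<forall>x y z. br x (br y z) + br y (br z x) + br z (br x y) = 0)"

definition lie_ideal :: "('n::finite cvec \<Rightarrow> 'n cvec \<Rightarrow> 'n cvec) \<Rightarrow> 'n cvec set \<Rightarrow> bool" where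
  "lie_ideal br I \<longleftrightarrow> vec.subspace I \<and> (\<forall>x i. i \<in> I \<longrightarrow> br x i \<in> I)"

text \<open>Simple: non-abelian and without nontrivial ideals.\<close>
definition simple_lie_algebra :: "('n::finite cvec \<Rightarrow> 'n cvec \<Rightarrow> 'n cvec) \<Rightarrow> bool" where
  "simple_lie_algebra br \<longleftrightarrow> lie_algebra br \<and> (\<exists>x y. br x y \<noteq> 0) \<and>
     (\<forall>I. lie_ideal br I \<longrightarrow> I = {0} \<or> I = UNIV)"

text \<open>Trace of a (complex-linear) endomorphism of complex^'n.\<close>
definition ctrace :: "('n::finite cvec \<Rightarrow> 'n cvec) \<Rightarrow> complex" where
  "ctrace L = (\<Sum>i\<in>UNIV. L (axis i 1) $ i)"

definition killing :: "('n::finite cvec \<Rightarrow> 'n cvec \<Rightarrow> 'n cvec) \<Rightarrow> 'n cvec \<Rightarrow> 'n cvec \<Rightarrow> complex" where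
  "killing br x y = ctrace (\<lambda>z. br x (br y z))"

definition lie_automorphism :: "('n::finite cvec \<Rightarrow> 'n cvec \<Rightarrow> 'n cvec) \<Rightarrow> ('n cvec \<Rightarrow> 'n cvec) \<Rightarrow> bool" where
  "lie_automorphism br s \<longleftrightarrow> Vector_Spaces.linear (*s) (*s) s \<and> bij s \<and>
     (\<forall>x y. s (br x y) = br (s x) (s y))"

text \<open>A real form of g, given by its conjugation tau (antilinear involutive Lie algebra
  automorphism); the real form is the fixed point set of tau.\<close>
definition real_form_conj :: "('n::finite cvec \<Rightarrow> 'n cvec \<Rightarrow> 'n cvec) \<Rightarrow> ('n cvec \<Rightarrow> 'n cvec) \<Rightarrow> bool" where
  "real_form_conj br tau \<longleftrightarrow>
     (\<forall>x y. tau (x + y) = tau x + tau y) \<and>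
     (\<forall>c x. tau (c *s x) = cnj c *s tau x) \<and>
     (\<forall>x. tau (tau x) = x) \<and>
     (\<forall>x y. tau (br x y) = br (tau x) (tau y))"

definition real_form :: "('n::finite cvec \<Rightarrow> 'n cvec) \<Rightarrow> 'n cvec set" where
  "real_form tau = {x. tau x = x}"

text \<open>sg is (sigma) the complexification of a Cartan involution theta of the real form:
  a complex-linear involutive automorphism of g preserving the real form, whose
  restriction theta satisfies: -B(X, theta X) > 0 for all nonzero X in the real form.\<close>
definition complexified_cartan_involution ::
  "('n::finite cvec \<Rightarrow> 'n cvec \<Rightarrow> 'n cvec) \<Rightarrow> ('n cvec \<Rightarrow> 'n cvec) \<Rightarrow> ('n cvec \<Rightarrow> 'n cvec) \<Rightarrow> bool" where
  "complexified_cartan_involution br tau sg \<longleftrightarrow>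
     lie_automorphism br sg \<and> (\<forall>x. sg (sg x) = x) \<and>
     (\<forall>x. tau (sg x) = sg (tau x)) \<and>
     (\<forall>x\<in>real_form tau. x \<noteq> 0 \<longrightarrow>
        Im (killing br x (sg x)) = 0 \<and> Re (killing br x (sg x)) < 0)"

definition plus_space :: "('n::finite cvec \<Rightarrow> 'n cvec) \<Rightarrow> 'n cvec set" where
  "plus_space sg = {x. sg x = x}"     (* h *)

definition minus_space :: "('n::finite cvec \<Rightarrow> 'n cvec) \<Rightarrow> 'n cvec set" where
  "minus_space sg = {x. sg x = - x}"  (* m *)

definition sl2_triple :: "('n::finite cvec \<Rightarrow> 'n cvec \<Rightarrow> 'n cvec) \<Rightarrow> 'n cvec \<Rightarrow> 'n cvec \<Rightarrow> 'n cvec \<Rightarrow> bool" where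
  "sl2_triple br e h f \<longleftrightarrow> br h e = 2 *s e \<and> br h f = - (2 *s f) \<and> br e f = h"

text \<open>Cayley transform of a (Cayley) real triple (ehat, hhat, fhat).\<close>
definition cayley_h :: "'n::finite cvec \<Rightarrow> 'n cvec \<Rightarrow> 'n cvec \<Rightarrow> 'n cvec" where
  "cayley_h eh hh fh = \<i> *s (eh - fh)"
definition cayley_e :: "'n::finite cvec \<Rightarrow> 'n cvec \<Rightarrow> 'n cvec \<Rightarrow> 'n cvec" where
  "cayley_e eh hh fh = (1/2) *s (eh + fh + \<i> *s hh)"
definition cayley_f :: "'n::finite cvec \<Rightarrow> 'n cvec \<Rightarrow> 'n cvec \<Rightarrow> 'n cvec" where
  "cayley_f eh hh fh = (1/2) *s (eh + fh - \<i> *s hh)"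

text \<open>g_j: j-eigenspace of ad_h.\<close>
definition grade_space :: "('n::finite cvec \<Rightarrow> 'n cvec \<Rightarrow> 'n cvec) \<Rightarrow> 'n cvec \<Rightarrow> int \<Rightarrow> 'n cvec set" where
  "grade_space br h j = {x. br h x = of_int j *s x}"

text \<open>V_j = W_j \<inter> ker ad_e: the highest weight vectors of weight j, i.e. ker ad_e \<inter> g_j.\<close>
definition hw_space :: "('n::finite cvec \<Rightarrow> 'n cvec \<Rightarrow> 'n cvec) \<Rightarrow> 'n cvec \<Rightarrow> 'n cvec \<Rightarrow> nat \<Rightarrow> 'n cvec set" where
  "hw_space br e h j = {x. br e x = 0 \<and> br h x = of_nat j *s x}"

text \<open>Centralizer c of {e,h,f}.\<close>
definition centralizer3 :: "('n::finite cvec \<Rightarrow> 'n cvec \<Rightarrow> 'n cvec) \<Rightarrow> 'n cvec \<Rightarrow> 'n cvec \<Rightarrow> 'n cvec \<Rightarrow> 'n cvec set" where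
  "centralizer3 br e h f = {x. br e x = 0 \<and> br h x = 0 \<and> br f x = 0}"

text \<open>A map s agrees with the magical linear map of (e,h,f) on the sum of the W_j, j even.
  Since W_j is the (direct) sum of the (ad_f)^k V_j, 0 \<le> k \<le> j, and the magical map is
  defined piecewise on these summands, agreement means agreement on each summand.\<close>
definition agrees_with_magical_even ::
  "('n::finite cvec \<Rightarrow> 'n cvec \<Rightarrow> 'n cvec) \<Rightarrow> ('n cvec \<Rightarrow> 'n cvec) \<Rightarrow> 'n cvec \<Rightarrow> 'n cvec \<Rightarrow> 'n cvec \<Rightarrow> bool" where
  "agrees_with_magical_even br s e h f \<longleftrightarrow>
     (\<forall>j k v. even j \<longrightarrow> k \<le> j \<longrightarrow> v \<in> hw_space br e h j \<longrightarrow>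
        s ((br f ^^ k) v) = (if j = 0 then (br f ^^ k) v
                              else ((-1) ^ (k + 1) :: complex) *s (br f ^^ k) v))"

text \<open>The real triple is extended magical iff its Cayley transform is extended magical with
  canonical real form the given real form, i.e. the involution sigma_rho can be taken to be
  the complexified Cartan involution sg of the given real form.\<close>
definition extended_magical_real ::
  "('n::finite cvec \<Rightarrow> 'n cvec \<Rightarrow> 'n cvec) \<Rightarrow> ('n cvec \<Rightarrow> 'n cvec) \<Rightarrow> 'n cvec \<Rightarrow> 'n cvec \<Rightarrow> 'n cvec \<Rightarrow> bool" where
  "extended_magical_real br sg eh hh fh \<longleftrightarrow>
     agrees_with_magical_even br sg (cayley_e eh hh fh) (cayley_h eh hh fh) (cayley_f eh hh fh)"

end

theory Submission
  imports Defs "HOL-Computational_Algebra.Fundamental_Theorem_Algebra"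
begin

text \<open>
  The Cayley transform (e, h, f) satisfies sigma e = -e, sigma h = h, sigma f = -f, and with
  theta = sigma tau the form <x, y> = -B(x, theta y) is positive definite Hermitian; ad e and ad f
  are adjoint for it and ad h is self-adjoint.  Hence ad h is diagonalisable with integral weights,
  g = ker ad e + im ad f (an orthogonal sum), ker ad e is the sum of the primitive spaces V_j, and
  (ad f)^j maps V_j isomorphically onto the lowest weight vectors of weight -j.  As sigma anticommutes
  with ad e and ad f, (ad f)^j multiplies the eigenvalues of sigma by (-1)^j, and counting the
  eigenspaces of sigma gives
    dim m - dim h = sum_k (dim (V_2k \<inter> m) - dim (V_2k \<inter> h)),   while   dim g_0 = sum_k dim V_2k.
  So dim m - dim h - dim g_0 + 2 dim c = 2 dim (c \<inter> m) - 2 sum_{k>0} dim (V_2k \<inter> h), and this vanishes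
  together with c \<inter> m exactly when sigma is +1 on c and -1 on every V_2k with k > 0, which is the
  extended magical condition.  On c \<inter> g^R we then have sigma = id, so the Cartan condition
  -B(x, sigma x) > 0 makes the Killing form negative definite there.
\<close>

section \<open>Dimension counting\<close>

lemma set_plus_eq_sums: "A + B = {x + y |x y. x \<in> A \<and> y \<in> B}"
  by (auto simp: set_plus_def)

context vector_space
begin

lemma subspace_set_plus: "subspace A \<Longrightarrow> subspace B \<Longrightarrow> subspace (A + B)"
  unfolding set_plus_eq_sums by (rule subspace_sums)

lemma span_Un_set_plus: "span (A \<union> B) = span A + span B"
  unfolding set_plus_eq_sums by (rule span_Un)

end

context finite_dimensional_vector_space
begin

lemma dim_set_plus_disjoint:
  assumes "subspace A" "subspace B" "A \<inter> B \<subseteq> {0}"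
  shows "dim (A + B) = dim A + dim B"
proof -
  have "dim (A \<inter> B) = 0" using assms(3) by simp
  then show ?thesis using dim_sums_Int[OF assms(1,2)] unfolding set_plus_eq_sums by linarith
qed

end

context finite_dimensional_vector_space_pair
begin

lemma dim_le_of_inj_on:
  assumes "Vector_Spaces.linear s1 s2 f" "vs1.subspace A" "inj_on f A" "f ` A \<subseteq> B"
  shows "vs1.dim A \<le> vs2.dim B"
proof -
  have "vs2.dim (f ` A) = vs1.dim A"
    using dim_image_eq[OF assms(1), of A] assms(3)
    unfolding vs1.span_eq_iff[THEN iffD2, OF assms(2)] by simp
  then show ?thesis using vs2.dim_subset[OF assms(4)] by simp
qed

lemma rank_nullity:
  assumes f: "Vector_Spaces.linear s1 s2 f" and S: "vs1.subspace S"
  shows "vs1.dim S = vs1.dim (S \<inter> {x. f x = 0}) + vs2.dim (f ` S)"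
proof -
  interpret f: Vector_Spaces.linear s1 s2 f by fact
  define K where "K = S \<inter> {x. f x = 0}"
  have K: "vs1.subspace K" unfolding K_def using S f.subspace_kernel by (rule vs1.subspace_inter)
  obtain B where B: "B \<subseteq> K" "vs1.independent B" "K \<subseteq> vs1.span B" "card B = vs1.dim K"
    using vs1.basis_exists[of K] by metis
  have "B \<subseteq> S" using B(1) by (auto simp: K_def)
  obtain C where C: "B \<subseteq> C" "C \<subseteq> S" "vs1.independent C" "S \<subseteq> vs1.span C"
    using vs1.maximal_independent_subset_extend[OF \<open>B \<subseteq> S\<close> B(2)] by blast
  define W where "W = vs1.span (C - B)"
  have "finite C" using C(3) vs1.finiteI_independent by blast
  have K_span: "vs1.span B = K" using vs1.span_minimal[OF B(1) K] B(3) by blast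
  have W: "vs1.subspace W" "W \<subseteq> S"
    unfolding W_def using vs1.span_minimal[of "C - B" S] C(2) S by auto
  have "vs1.span C = K + W"
    using vs1.span_Un_set_plus[of B "C - B"] C(1) K_span unfolding W_def
    by (simp add: Un_absorb1 Un_Diff_cancel)
  also have "vs1.span C = S" using vs1.span_minimal[OF C(2) S] C(4) by blast
  finally have S_sum: "S = K + W" .
  have "vs1.dim (K + W) + vs1.dim (K \<inter> W) = vs1.dim K + vs1.dim W"
    using vs1.dim_sums_Int[OF K W(1)] unfolding set_plus_eq_sums .
  moreover have "vs1.dim S = card C" "vs1.dim K = card B" "vs1.dim W = card (C - B)"
    using vs1.basis_card_eq_dim[OF C(2,4,3)] vs1.basis_card_eq_dim[OF B(1,3,2)]
      vs1.dim_span_eq_card_independent[OF vs1.independent_mono[OF C(3)]]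
    by (auto simp: W_def)
  moreover have "card C = card B + card (C - B)"
    using card_Diff_subset[OF finite_subset[OF C(1) \<open>finite C\<close>] C(1)] card_mono[OF \<open>finite C\<close> C(1)]
    by simp
  ultimately have "vs1.dim (K \<inter> W) = 0" using S_sum by simp
  then have KW: "K \<inter> W \<subseteq> {0}" by simp
  have "inj_on f W"
  proof (rule inj_onI)
    fix x y assume "x \<in> W" "y \<in> W" "f x = f y"
    then have "x - y \<in> K \<inter> W"
      using W vs1.subspace_diff by (auto simp: K_def f.diff)
    then show "x = y" using KW by auto
  qed
  then have "vs2.dim (f ` W) = vs1.dim W"
    using dim_image_eq[OF f, of W] unfolding W_def by (simp add: vs1.span_span)
  moreover have "f ` S = f ` W"
  proof
    show "f ` S \<subseteq> f ` W"
    proof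
      fix y assume "y \<in> f ` S"
      then obtain k w where "k \<in> K" "w \<in> W" "y = f (k + w)"
        unfolding S_sum set_plus_def by blast
      then show "y \<in> f ` W" by (auto simp: K_def f.add)
    qed
  qed (use W(2) in blast)
  moreover have "vs1.dim S = vs1.dim K + vs1.dim W"
    using vs1.dim_set_plus_disjoint[OF K W(1) KW] S_sum by simp
  ultimately show ?thesis unfolding K_def[symmetric] by simp
qed

end

section \<open>Eigenvectors of complex-linear operators\<close>

abbreviation clinear :: "('n::finite cvec \<Rightarrow> 'n cvec) \<Rightarrow> bool" where
  "clinear f \<equiv> Vector_Spaces.linear ((*s) :: complex \<Rightarrow> _) (*s) f"

lemma clinear_funpow: "clinear T \<Longrightarrow> clinear (T ^^ k)"
proof (induction k)
  case 0
  then show ?case using vec.linear_id by (simp add: id_def)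
next
  case (Suc k)
  then show ?case
    using Vector_Spaces.linear_compose[of "(*s)" "(*s)" "T ^^ k" "(*s)" T] by (simp only: funpow.simps(2))
qed

text \<open>The vector p(T) v, computed by Horner's scheme.\<close>
definition poly_apply :: "complex poly \<Rightarrow> ('n::finite cvec \<Rightarrow> 'n cvec) \<Rightarrow> 'n cvec \<Rightarrow> 'n cvec" where
  "poly_apply p T v = fold_coeffs (\<lambda>a w. a *s v + T w) p 0"

lemma poly_apply_0 [simp]: "poly_apply 0 T v = 0"
  by (simp add: poly_apply_def)

context
  fixes T :: "'n::finite cvec \<Rightarrow> 'n cvec"
  assumes T: "clinear T"
begin

lemma poly_apply_pCons: "poly_apply (pCons a p) T v = a *s v + T (poly_apply p T v)"
  using vec.linear_0[OF T] by (cases "a = 0 \<and> p = 0") (auto simp: poly_apply_def)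

lemma poly_apply_add: "poly_apply (p + q) T v = poly_apply p T v + poly_apply q T v"
proof (induction p arbitrary: q rule: pCons_induct)
  case (pCons a p)
  then show ?case
    by (cases q rule: pCons_cases)
      (simp add: poly_apply_pCons vec.linear_add[OF T] vector_sadd_rdistrib algebra_simps)
qed simp

lemma poly_apply_smult: "poly_apply (smult c p) T v = c *s poly_apply p T v"
  by (induction p rule: pCons_induct)
    (simp_all add: poly_apply_pCons vec.linear_scale[OF T] vector_add_ldistrib)

lemma poly_apply_mult: "poly_apply (p * q) T v = poly_apply p T (poly_apply q T v)"
  by (induction p rule: pCons_induct) (simp_all add: poly_apply_add poly_apply_smult poly_apply_pCons)

lemma poly_apply_diff: "poly_apply (p - q) T v = poly_apply p T v - poly_apply q T v"
  using poly_apply_add[of p "smult (-1) q"] poly_apply_smult[of "-1" q]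
  by (simp add: vector_sneg_minus1[symmetric])

lemma poly_apply_sum: "poly_apply (\<Sum>i\<in>A. p i) T v = (\<Sum>i\<in>A. poly_apply (p i) T v)"
  by (induction A rule: infinite_finite_induct) (simp_all add: poly_apply_add)

lemma poly_apply_monom: "poly_apply (monom c k) T v = c *s (T ^^ k) v"
  by (induction k) (simp_all add: monom_0 monom_Suc poly_apply_pCons vec.linear_scale[OF T] vec.linear_0[OF T])

lemma poly_apply_in_invariant_subspace:
  assumes "vec.subspace S" "\<And>x. x \<in> S \<Longrightarrow> T x \<in> S" "v \<in> S"
  shows "poly_apply p T v \<in> S"
  by (induction p rule: pCons_induct)
    (use assms in \<open>simp_all add: poly_apply_pCons vec.subspace_0 vec.subspace_add vec.subspace_scale\<close>)

lemma eigenvector_of_poly_annihilator: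
  assumes S: "vec.subspace S" and TS: "\<And>x. x \<in> S \<Longrightarrow> T x \<in> S"
    and "v \<in> S" "v \<noteq> 0" "p \<noteq> 0" "poly_apply p T v = 0"
  shows "\<exists>x\<in>S. x \<noteq> 0 \<and> (\<exists>c. T x = c *s x)"
  using assms(3-)
proof (induction "degree p" arbitrary: p v rule: less_induct)
  case less
  show ?case
  proof (cases "degree p = 0")
    case True
    then obtain c where "p = [:c:]" by (metis degree_eq_zeroE)
    with less.prems show ?thesis by (simp add: poly_apply_pCons vec.linear_0[OF T])
  next
    case False
    then obtain z where "poly p z = 0"
      using fundamental_theorem_of_algebra[of p] by (auto simp: constant_degree)
    then obtain q where pq: "p = [:-z, 1:] * q"
      using poly_eq_0_iff_dvd by (blast elim: dvdE)
    with less.prems have "q \<noteq> 0" by auto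
    then have "degree q < degree p"
      using degree_mult_eq[of "[:-z, 1:]" q] by (simp add: pq del: mult_pCons_left)
    define u where "u = poly_apply q T v"
    have "u \<in> S" unfolding u_def using poly_apply_in_invariant_subspace[OF S TS less.prems(1)] .
    have "poly_apply p T v = T u - z *s u"
      by (simp add: pq poly_apply_mult poly_apply_pCons u_def vec.linear_0[OF T] del: mult_pCons_left)
    then have "T u = z *s u" using less.prems(4) by simp
    show ?thesis
    proof (cases "u = 0")
      case True
      then show ?thesis using less.hyps[OF \<open>degree q < degree p\<close> less.prems(1,2) \<open>q \<noteq> 0\<close>] u_def by simp
    qed (use \<open>u \<in> S\<close> \<open>T u = z *s u\<close> in blast)
  qed
qed

end

lemma in_span_image_lessThan_sum:
  fixes f :: "nat \<Rightarrow> 'n::finite cvec"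
  assumes "y \<in> vec.span (f ` {..<m})"
  shows "\<exists>c. y = (\<Sum>k<m. c k *s f k)"
  using assms
proof (induction m arbitrary: y)
  case (Suc m)
  then obtain a where "y - a *s f m \<in> vec.span (f ` {..<m})"
    by (auto simp: lessThan_Suc vec.span_insert)
  then obtain c where c: "y - a *s f m = (\<Sum>k<m. c k *s f k)" using Suc.IH by blast
  have "(\<Sum>k<m. (c(m := a)) k *s f k) = (\<Sum>k<m. c k *s f k)" by (rule sum.cong) auto
  then have "y = (\<Sum>k<Suc m. (c(m := a)) k *s f k)" using c by (simp add: algebra_simps)
  then show ?case by blast
qed simp

lemma funpow_in_span_of_lower_powers:
  fixes T :: "'n::finite cvec \<Rightarrow> 'n cvec"
  shows "\<exists>m. (T ^^ m) v \<in> vec.span ((\<lambda>k. (T ^^ k) v) ` {..<m})"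
proof (rule ccontr)
  assume no_power: "\<not> ?thesis"
  have indep: "vec.independent ((\<lambda>k. (T ^^ k) v) ` {..<N}) \<and> card ((\<lambda>k. (T ^^ k) v) ` {..<N}) = N" for N
  proof (induction N)
    case (Suc N)
    let ?P = "(\<lambda>k. (T ^^ k) v) ` {..<N}"
    have "(T ^^ N) v \<notin> vec.span ?P" using no_power by blast
    then have "vec.independent (insert ((T ^^ N) v) ?P)"
      using Suc.IH vec.independent_insertI by blast
    moreover have "(T ^^ N) v \<notin> ?P" using \<open>(T ^^ N) v \<notin> vec.span ?P\<close> by (metis vec.span_base)
    ultimately show ?case using Suc.IH by (simp add: lessThan_Suc)
  qed (simp add: vec.independent_empty)
  show False
    using vec.independent_card_le_dim[OF subset_UNIV, of "(\<lambda>k. (T ^^ k) v) ` {..<Suc CARD('n)}"]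
      indep by (simp add: card_cart_basis)
qed

lemma invariant_subspace_has_eigenvector:
  fixes T :: "'n::finite cvec \<Rightarrow> 'n cvec"
  assumes T: "clinear T" and S: "vec.subspace S" and TS: "\<And>x. x \<in> S \<Longrightarrow> T x \<in> S"
    and v: "v \<in> S" "v \<noteq> 0"
  shows "\<exists>x\<in>S. x \<noteq> 0 \<and> (\<exists>c. T x = c *s x)"
proof -
  obtain m where "(T ^^ m) v \<in> vec.span ((\<lambda>k. (T ^^ k) v) ` {..<m})"
    using funpow_in_span_of_lower_powers by blast
  then obtain c where c: "(T ^^ m) v = (\<Sum>k<m. c k *s (T ^^ k) v)"
    using in_span_image_lessThan_sum by blast
  define p where "p = monom 1 m - (\<Sum>k<m. monom (c k) k)"
  have "coeff p m = 1" by (simp add: p_def coeff_sum coeff_monom)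
  then have "p \<noteq> 0" by auto
  moreover have "poly_apply p T v = 0"
    using c by (simp add: p_def poly_apply_diff[OF T] poly_apply_sum[OF T] poly_apply_monom[OF T])
  ultimately show ?thesis using eigenvector_of_poly_annihilator[OF T S TS v] by blast
qed

section \<open>Eigenspaces of an involution\<close>

definition eigen_dim :: "('n::finite cvec \<Rightarrow> 'n cvec) \<Rightarrow> complex \<Rightarrow> 'n cvec set \<Rightarrow> nat" where
  "eigen_dim T s S = vec.dim (S \<inter> {x. T x = s *s x})"

lemma eigen_dim_trivial: "S \<subseteq> {0} \<Longrightarrow> eigen_dim T s S = 0"
  unfolding eigen_dim_def by auto

lemma eigenspace_subspace: "clinear T \<Longrightarrow> vec.subspace {x. T x = s *s x}"
  unfolding vec.subspace_def
  by (simp add: vec.linear_0 vec.linear_add vec.linear_scale vector_add_ldistrib vector_smult_assoc mult.commute)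

lemma eigen_dim_set_plus:
  assumes T: "clinear T"
    and P: "vec.subspace P" "T ` P \<subseteq> P" and Q: "vec.subspace Q" "T ` Q \<subseteq> Q" and PQ: "P \<inter> Q \<subseteq> {0}"
  shows "eigen_dim T s (P + Q) = eigen_dim T s P + eigen_dim T s Q"
proof -
  let ?V = "{x. T x = s *s x}"
  have "(P + Q) \<inter> ?V \<subseteq> (P \<inter> ?V) + (Q \<inter> ?V)"
  proof
    fix x assume "x \<in> (P + Q) \<inter> ?V"
    then obtain p q where pq: "x = p + q" "p \<in> P" "q \<in> Q" "T (p + q) = s *s (p + q)"
      by (auto simp: set_plus_def)
    then have eq: "T p - s *s p = s *s q - T q"
      by (simp add: vec.linear_add[OF T] vector_add_ldistrib algebra_simps)
    have "T p - s *s p \<in> P" "s *s q - T q \<in> Q"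
      using P Q pq(2,3) by (simp_all add: image_subset_iff vec.subspace_diff vec.subspace_scale)
    then have "T p - s *s p = 0" using eq PQ by auto
    then have "T p = s *s p" "T q = s *s q" using eq by simp_all
    with pq show "x \<in> (P \<inter> ?V) + (Q \<inter> ?V)" by (auto simp: set_plus_def)
  qed
  moreover have "(P \<inter> ?V) + (Q \<inter> ?V) \<subseteq> (P + Q) \<inter> ?V"
    by (auto simp: set_plus_def vec.linear_add[OF T] vector_add_ldistrib)
  ultimately have "(P + Q) \<inter> ?V = (P \<inter> ?V) + (Q \<inter> ?V)" by blast
  moreover have "vec.subspace (P \<inter> ?V)" "vec.subspace (Q \<inter> ?V)"
    using P(1) Q(1) eigenspace_subspace[OF T] by (auto intro: vec.subspace_inter)
  moreover have "(P \<inter> ?V) \<inter> (Q \<inter> ?V) \<subseteq> {0}" using PQ by blast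
  ultimately show ?thesis
    unfolding eigen_dim_def by (simp add: vec.dim_set_plus_disjoint)
qed

context
  fixes T :: "'n::finite cvec \<Rightarrow> 'n cvec"
  assumes T: "clinear T" and T_T: "\<And>x. T (T x) = x"
begin

lemma subset_set_plus_involution_eigenspaces:
  assumes S: "vec.subspace S" "T ` S \<subseteq> S"
  shows "S \<subseteq> (S \<inter> {x. T x = 1 *s x}) + (S \<inter> {x. T x = (- 1) *s x})"
proof
  fix x assume "x \<in> S"
  define p q where "p = (1/2) *s (x + T x)" and "q = (1/2) *s (x - T x)"
  have "p \<in> S" "q \<in> S"
    using S \<open>x \<in> S\<close>
    by (simp_all add: p_def q_def image_subset_iff vec.subspace_add vec.subspace_diff vec.subspace_scale)
  moreover have "T p = 1 *s p" "T q = (- 1) *s q"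
    by (simp_all add: p_def q_def vec.linear_add[OF T] vec.linear_diff[OF T] vec.linear_scale[OF T] T_T
        vec_eq_iff algebra_simps)
  ultimately have "p + q \<in> (S \<inter> {x. T x = 1 *s x}) + (S \<inter> {x. T x = (- 1) *s x})"
    by (intro set_plus_intro) simp_all
  moreover have "x = p + q" by (simp add: p_def q_def vec_eq_iff field_simps)
  ultimately show "x \<in> (S \<inter> {x. T x = 1 *s x}) + (S \<inter> {x. T x = (- 1) *s x})" by simp
qed

lemma dim_eq_eigen_dim_plus_minus:
  assumes "vec.subspace S" "T ` S \<subseteq> S"
  shows "vec.dim S = eigen_dim T 1 S + eigen_dim T (- 1) S"
proof -
  have sub: "vec.subspace (S \<inter> {x. T x = c *s x})" for c
    using assms(1) eigenspace_subspace[OF T] by (rule vec.subspace_inter)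
  have "(S \<inter> {x. T x = 1 *s x}) + (S \<inter> {x. T x = (- 1) *s x}) \<subseteq> S"
    using assms(1) by (auto elim!: set_plus_elim intro: vec.subspace_add)
  then have "vec.dim S = vec.dim ((S \<inter> {x. T x = 1 *s x}) + (S \<inter> {x. T x = (- 1) *s x}))"
    using subset_set_plus_involution_eigenspaces[OF assms] by (metis subset_antisym)
  also have "\<dots> = eigen_dim T 1 S + eigen_dim T (- 1) S"
    unfolding eigen_dim_def by (rule vec.dim_set_plus_disjoint[OF sub sub]) (auto simp: vec_eq_iff)
  finally show ?thesis .
qed

lemma subset_eigenspace_iff:
  assumes "vec.subspace S" "T ` S \<subseteq> S" "s \<in> {1, - 1}"
  shows "S \<subseteq> {x. T x = s *s x} \<longleftrightarrow> eigen_dim T (- s) S = 0"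
proof -
  have "S \<subseteq> {x. T x = s *s x} \<longleftrightarrow> S \<inter> {x. T x = (- s) *s x} \<subseteq> {0}"
  proof
    assume "S \<subseteq> {x. T x = s *s x}"
    then show "S \<inter> {x. T x = (- s) *s x} \<subseteq> {0}"
      using assms(3) by (auto simp: vec_eq_iff)
  next
    assume trivial: "S \<inter> {x. T x = (- s) *s x} \<subseteq> {0}"
    show "S \<subseteq> {x. T x = s *s x}"
    proof
      fix x assume "x \<in> S"
      then obtain p q where "x = p + q" "p \<in> S" "T p = p" "q \<in> S" "T q = - q"
        using subset_set_plus_involution_eigenspaces[OF assms(1,2)]
        by (auto elim!: set_plus_elim simp: vector_sneg_minus1[symmetric])
      then show "x \<in> {x. T x = s *s x}"
        using trivial assms(3) by (auto simp: vector_sneg_minus1[symmetric])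
    qed
  qed
  then show ?thesis by (simp add: eigen_dim_def)
qed

end

section \<open>sl2-modules with an invariant Hermitian form\<close>

text \<open>
  E, F, H model ad e, ad f, ad h for an sl2-triple (e, h, f) acting on g, and ip models the
  form -B(x, theta y), which is linear in the first argument.
\<close>
locale hermitian_sl2 =
  E: Vector_Spaces.linear "(*s) :: complex \<Rightarrow> 'n cvec \<Rightarrow> 'n cvec" "(*s)" E +
  F: Vector_Spaces.linear "(*s) :: complex \<Rightarrow> 'n cvec \<Rightarrow> 'n cvec" "(*s)" F +
  H: Vector_Spaces.linear "(*s) :: complex \<Rightarrow> 'n cvec \<Rightarrow> 'n cvec" "(*s)" H
  for E F H :: "'n::finite cvec \<Rightarrow> 'n cvec" +
  fixes ip :: "'n cvec \<Rightarrow> 'n cvec \<Rightarrow> complex"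
  assumes H_E: "\<And>x. H (E x) = E (H x) + 2 *s E x"
    and H_F: "\<And>x. H (F x) = F (H x) - 2 *s F x"
    and E_F: "\<And>x. E (F x) = F (E x) + H x"
    and ip_add_left: "\<And>x y z. ip (x + y) z = ip x z + ip y z"
    and ip_scale_left: "\<And>c x z. ip (c *s x) z = c * ip x z"
    and ip_add_right: "\<And>x y z. ip z (x + y) = ip z x + ip z y"
    and ip_scale_right: "\<And>c x z. ip z (c *s x) = cnj c * ip z x"
    and ip_self_pos: "\<And>x. x \<noteq> 0 \<Longrightarrow> Re (ip x x) > 0"
    and ip_E_adjoint: "\<And>x y. ip (E x) y = ip x (F y)"
    and ip_F_adjoint: "\<And>x y. ip (F x) y = ip x (E y)"
    and ip_H_adjoint: "\<And>x y. ip (H x) y = ip x (H y)"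
begin

definition weight_space :: "complex \<Rightarrow> 'n cvec set" where
  "weight_space c = {x. H x = c *s x}"

text \<open>The space V_j of the paper when c = j.\<close>
definition primitive_space :: "complex \<Rightarrow> 'n cvec set" where
  "primitive_space c = {x. E x = 0 \<and> H x = c *s x}"

lemma ip_zero_left [simp]: "ip 0 y = 0"
  using ip_scale_left[of 0 0 y] by simp

lemma ip_zero_right [simp]: "ip y 0 = 0"
  using ip_scale_right[of y 0 0] by simp

lemma ip_diff_left: "ip (x - z) y = ip x y - ip z y"
  using ip_add_left[of "x - z" z y] by simp

lemma ip_sum_left: "ip (\<Sum>i\<in>A. f i) y = (\<Sum>i\<in>A. ip (f i) y)"
  by (induction A rule: infinite_finite_induct) (simp_all add: ip_add_left)

lemma ip_self_eq_0_iff [simp]: "ip x x = 0 \<longleftrightarrow> x = 0"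
  using ip_self_pos[of x] by force

lemma ip_self_nonneg: "Re (ip x x) \<ge> 0"
  using ip_self_pos[of x] by (cases "x = 0") auto

lemma weight_space_subspace: "vec.subspace (weight_space c)"
  unfolding vec.subspace_def weight_space_def
  by (simp add: H.add H.scale vector_add_ldistrib vector_smult_assoc mult.commute)

lemma primitive_space_eq: "primitive_space c = {x. E x = 0} \<inter> weight_space c"
  by (auto simp: primitive_space_def weight_space_def)

lemma primitive_space_subspace: "vec.subspace (primitive_space c)"
  unfolding primitive_space_eq by (rule vec.subspace_inter[OF E.subspace_kernel weight_space_subspace])

lemma ip_weight_vectors_orthogonal:
  assumes "H x = a *s x" "H y = b *s y" "a \<noteq> b"
  shows "ip x y = 0"
proof (cases "y = 0")
  case False
  have "b * ip y y = cnj b * ip y y"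
    using ip_H_adjoint[of y y] assms(2) by (simp add: ip_scale_left ip_scale_right)
  then have "cnj b = b" using False by simp
  then have "a * ip x y = b * ip x y"
    using ip_H_adjoint[of x y] assms(1,2) by (simp add: ip_scale_left ip_scale_right)
  then show ?thesis using assms(3) by simp
qed simp

lemma card_weights_le_dim:
  assumes "finite L" and v: "\<And>c. c \<in> L \<Longrightarrow> v c \<noteq> 0 \<and> H (v c) = c *s v c"
  shows "card L \<le> CARD('n)"
proof -
  have orth: "ip (v a) (v b) = 0" if "a \<in> L" "b \<in> L" "a \<noteq> b" for a b
    using ip_weight_vectors_orthogonal v that by blast
  have "inj_on v L"
    by (rule inj_onI) (metis orth v ip_self_eq_0_iff)
  have "vec.independent (v ` L)"
    unfolding vec.independent_explicit
  proof (intro conjI allI impI ballI)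
    show "finite (v ` L)" using \<open>finite L\<close> by simp
  next
    fix c :: "'n cvec \<Rightarrow> complex" and w
    assume sum0: "(\<Sum>u\<in>v ` L. c u *s u) = 0" and "w \<in> v ` L"
    then obtain a where a: "a \<in> L" "w = v a" by auto
    have "0 = (\<Sum>u\<in>v ` L. c u * ip u w)"
      using ip_sum_left[of "\<lambda>u. c u *s u" "v ` L" w] sum0 by (simp add: ip_scale_left)
    also have "\<dots> = c w * ip w w"
    proof -
      have "(\<Sum>u\<in>v ` L - {w}. c u * ip u w) = 0"
        by (rule sum.neutral) (use a orth in auto)
      then show ?thesis
        using sum.remove[of "v ` L" w "\<lambda>u. c u * ip u w"] \<open>finite L\<close> \<open>w \<in> v ` L\<close> by simp
    qed
    finally show "c w = 0" using v[OF a(1)] a(2) by simp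
  qed
  then have "card (v ` L) \<le> CARD('n)"
    using vec.independent_card_le_dim[of "v ` L" UNIV] by (simp add: card_cart_basis)
  then show ?thesis using card_image[OF \<open>inj_on v L\<close>] by simp
qed

lemma no_injective_weight_sequence:
  assumes "inj (f :: nat \<Rightarrow> complex)" and "\<And>k. \<exists>x. x \<noteq> 0 \<and> H x = f k *s x"
  shows False
proof -
  define d where "d = CARD('n)"
  obtain v where v: "\<And>k. v k \<noteq> 0 \<and> H (v k) = f k *s v k" using assms(2) by metis
  have "card (f ` {..d}) \<le> d"
    unfolding d_def by (rule card_weights_le_dim[of _ "\<lambda>c. v (inv f c)"]) (auto simp: v inv_f_f[OF assms(1)])
  moreover have "card (f ` {..d}) = Suc d"
    using card_image[OF inj_on_subset[OF assms(1)]] by simp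
  ultimately show False by simp
qed

lemma H_funpow_F:
  assumes "H x = c *s x"
  shows "H ((F ^^ k) x) = (c - 2 * of_nat k) *s (F ^^ k) x"
proof (induction k)
  case (Suc k)
  have "H ((F ^^ Suc k) x) = (c - 2 * of_nat k) *s F ((F ^^ k) x) - 2 *s F ((F ^^ k) x)"
    using Suc.IH by (simp add: H_F F.scale F.diff)
  then show ?case by (simp add: vec_eq_iff algebra_simps)
qed (simp add: assms)

lemma E_funpow_F:
  assumes "v \<in> primitive_space c"
  shows "E ((F ^^ Suc k) v) = (of_nat (Suc k) * (c - of_nat k)) *s (F ^^ k) v"
proof (induction k)
  case 0
  then show ?case using assms by (simp add: primitive_space_def E_F)
next
  case (Suc k)
  have "E ((F ^^ Suc (Suc k)) v) = F (E ((F ^^ Suc k) v)) + H ((F ^^ Suc k) v)"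
    by (simp add: E_F)
  also have "\<dots> = (of_nat (Suc k) * (c - of_nat k)) *s (F ^^ Suc k) v
      + (c - 2 * of_nat (Suc k)) *s (F ^^ Suc k) v"
    using Suc.IH H_funpow_F[of v c "Suc k"] assms
    by (simp only: F.scale funpow.simps(2) o_apply primitive_space_def mem_Collect_eq)
  also have "\<dots> = (of_nat (Suc (Suc k)) * (c - of_nat (Suc k))) *s (F ^^ Suc k) v"
    by (simp add: vec_eq_iff algebra_simps)
  finally show ?case .
qed

lemma ip_F_self:
  assumes "H x = c *s x" "cnj c = c"
  shows "ip (F x) (F x) = ip (E x) (E x) + c * ip x x"
  using assms by (simp add: ip_F_adjoint E_F ip_add_right ip_E_adjoint ip_scale_right)

lemma F_eq_0_pos_weight:
  assumes "H x = of_nat j *s x" "0 < j" "F x = 0"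
  shows "x = 0"
proof (rule ccontr)
  assume "x \<noteq> 0"
  have "ip (E x) (E x) + of_nat j * ip x x = 0"
    using ip_F_self[OF assms(1)] assms(3) by simp
  then have "Re (ip (E x) (E x) + of_nat j * ip x x) = 0" by simp
  then have "0 = Re (ip (E x) (E x)) + of_nat j * Re (ip x x)" by simp
  moreover have "of_nat j * Re (ip x x) > 0" using ip_self_pos[OF \<open>x \<noteq> 0\<close>] assms(2) by simp
  ultimately show False using ip_self_nonneg[of "E x"] by linarith
qed

lemma F_eq_0_weight_0:
  assumes "E x = 0" "H x = 0"
  shows "F x = 0"
  using ip_F_self[of x 0] assms by simp

lemma funpow_F_primitive_neq_0:
  assumes "v \<in> primitive_space c" "v \<noteq> 0" "\<forall>i<k. c \<noteq> of_nat i"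
  shows "(F ^^ k) v \<noteq> 0"
  using assms(3)
proof (induction k)
  case (Suc k)
  then have "(of_nat (Suc k) * (c - of_nat k)) *s (F ^^ k) v \<noteq> 0"
    by (simp del: of_nat_Suc)
  then show ?case using E_funpow_F[OF assms(1), of k] by auto
qed (use assms(2) in simp)

lemma primitive_weight_nat:
  assumes "v \<in> primitive_space c" "v \<noteq> 0"
  shows "\<exists>j. c = of_nat j \<and> j < CARD('n)"
proof -
  have Hv: "H v = c *s v" using assms(1) by (simp add: primitive_space_def)
  have weight: "\<exists>x. x \<noteq> 0 \<and> H x = (c - 2 * of_nat k) *s x" if "\<forall>i<k. c \<noteq> of_nat i" for k
    using funpow_F_primitive_neq_0[OF assms that] H_funpow_F[OF Hv] by blast
  have "inj (\<lambda>k::nat. c - 2 * of_nat k)" by (rule injI) simp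
  then obtain j where j: "c = of_nat j"
    using no_injective_weight_sequence weight by blast
  let ?L = "(\<lambda>k::nat. c - 2 * of_nat k) ` {..j}"
  have "\<forall>l\<in>?L. \<exists>x. x \<noteq> 0 \<and> H x = l *s x" using weight j by auto
  then obtain w where "\<And>l. l \<in> ?L \<Longrightarrow> w l \<noteq> 0 \<and> H (w l) = l *s w l" by metis
  then have "card ?L \<le> CARD('n)" by (intro card_weights_le_dim[of _ w]) auto
  moreover have "inj_on (\<lambda>k::nat. c - 2 * of_nat k) {..j}" by (rule inj_onI) simp
  ultimately show ?thesis using j by (simp add: card_image)
qed

lemma primitive_space_trivial:
  "CARD('n) \<le> j \<Longrightarrow> primitive_space (of_nat j) \<subseteq> {0}"
  using primitive_weight_nat by fastforce

lemma funpow_F_primitive_eq_0: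
  assumes "v \<in> primitive_space (of_nat j)"
  shows "(F ^^ Suc j) v = 0"
proof -
  have "ip ((F ^^ Suc j) v) ((F ^^ Suc j) v) = ip ((F ^^ j) v) (E ((F ^^ Suc j) v))"
    by (simp add: ip_F_adjoint)
  also have "\<dots> = 0" using E_funpow_F[OF assms, of j] by simp
  finally show ?thesis by simp
qed

lemma ip_neg_left: "ip (- x) y = - ip x y"
  using ip_scale_left[of "-1" x y] by (simp add: vector_sneg_minus1[symmetric])

lemma ip_neg_right: "ip y (- x) = - ip y x"
  using ip_scale_right[of y "-1" x] by (simp add: vector_sneg_minus1[symmetric])

lemma mirror: "hermitian_sl2 F E (\<lambda>x. - H x) ip"
proof (rule hermitian_sl2.intro[OF F.linear_axioms E.linear_axioms])
  show "clinear (\<lambda>x. - H x)" by (rule vec.linear_compose_neg[OF H.linear_axioms])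
  show "hermitian_sl2_axioms F E (\<lambda>x. - H x) ip"
    by unfold_locales
      (simp_all add: H_E H_F E_F E.neg F.neg ip_add_left ip_scale_left ip_add_right ip_scale_right
        ip_self_pos ip_E_adjoint ip_F_adjoint ip_neg_left ip_neg_right ip_H_adjoint)
qed

abbreviation lowest_weight_space :: "complex \<Rightarrow> 'n cvec set" where
  "lowest_weight_space \<equiv> hermitian_sl2.primitive_space F (\<lambda>x. - H x)"

lemma H_funpow_E:
  assumes "H x = c *s x"
  shows "H ((E ^^ k) x) = (c + 2 * of_nat k) *s (E ^^ k) x"
proof -
  interpret mirror: hermitian_sl2 F E "\<lambda>x. - H x" ip by (rule mirror)
  have "- H x = (- c) *s x" using assms by (simp add: vec_eq_iff)
  from mirror.H_funpow_F[OF this, of k] show ?thesis by (simp add: vec_eq_iff algebra_simps)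
qed

lemma weight_space_trivial:
  assumes "CARD('n) \<le> j"
  shows "weight_space (of_nat j) \<subseteq> {0}"
proof
  fix x assume x: "x \<in> weight_space (of_nat j)"
  then have Ek: "H ((E ^^ k) x) = (of_nat j + 2 * of_nat k) *s (E ^^ k) x" for k
    using H_funpow_E by (simp add: weight_space_def)
  have "inj (\<lambda>k::nat. of_nat j + 2 * of_nat k :: complex)" by (rule injI) simp
  then obtain k where "(E ^^ k) x = 0"
    using no_injective_weight_sequence Ek by blast
  then obtain k where k: "(E ^^ k) x = 0" "\<forall>i<k. (E ^^ i) x \<noteq> 0"
    using exists_least_iff[of "\<lambda>k. (E ^^ k) x = 0"] by blast
  show "x \<in> {0}"
  proof (cases k)
    case (Suc m)
    then have "(E ^^ m) x \<in> primitive_space (of_nat (j + 2 * m))"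
      using k(1) Ek[of m] by (simp add: primitive_space_def)
    moreover have "(E ^^ m) x \<noteq> 0" using k(2) Suc by simp
    ultimately show ?thesis using primitive_space_trivial[of "j + 2 * m"] assms by auto
  qed (use k in simp)
qed

text \<open>
  H is self-adjoint, so the orthogonal complement of an eigenvector inside S is again H-invariant.
\<close>
lemma invariant_subspace_spanned_by_weight_vectors:
  "vec.subspace S \<Longrightarrow> (\<And>x. x \<in> S \<Longrightarrow> H x \<in> S) \<Longrightarrow> S \<subseteq> vec.span (\<Union>c. S \<inter> weight_space c)"
proof (induction "vec.dim S" arbitrary: S rule: less_induct)
  case less
  show ?case
  proof (cases "S \<subseteq> {0}")
    case False
    then obtain v where "v \<in> S" "v \<noteq> 0" by auto
    then obtain u c where u: "u \<in> S" "u \<noteq> 0" "H u = c *s u"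
      using invariant_subspace_has_eigenvector[OF H.linear_axioms less.prems] by blast
    define S' where "S' = {x \<in> S. ip x u = 0}"
    have "vec.subspace S'"
      using less.prems(1) by (auto simp: S'_def vec.subspace_def ip_add_left ip_scale_left)
    moreover have "H x \<in> S'" if "x \<in> S'" for x
      using that less.prems(2) u(3) by (simp add: S'_def ip_H_adjoint ip_scale_right)
    moreover have "vec.dim S' < vec.dim S"
    proof (rule vec.dim_psubset)
      have "u \<notin> S'" using u by (simp add: S'_def)
      then have "S' \<subset> S" using u(1) unfolding S'_def by blast
      then show "vec.span S' \<subset> vec.span S"
        using \<open>vec.subspace S'\<close> less.prems(1) by (metis vec.span_eq_iff)
    qed
    ultimately have IH: "S' \<subseteq> vec.span (\<Union>c. S' \<inter> weight_space c)"
      using less.hyps by blast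
    have span_mono: "vec.span (\<Union>c. S' \<inter> weight_space c) \<subseteq> vec.span (\<Union>c. S \<inter> weight_space c)"
      by (rule vec.span_mono) (auto simp: S'_def)
    have u_in: "u \<in> vec.span (\<Union>c. S \<inter> weight_space c)"
      using u by (intro vec.span_base) (auto simp: weight_space_def)
    show ?thesis
    proof
      fix x assume "x \<in> S"
      define a where "a = ip x u / ip u u"
      have "x - a *s u \<in> S'"
        using \<open>x \<in> S\<close> u less.prems(1)
        by (simp add: S'_def ip_diff_left ip_scale_left a_def vec.subspace_diff vec.subspace_scale)
      then have "(x - a *s u) + a *s u \<in> vec.span (\<Union>c. S \<inter> weight_space c)"
        using IH span_mono u_in by (meson subsetD vec.span_add vec.span_scale)
      then show "x \<in> vec.span (\<Union>c. S \<inter> weight_space c)" by simp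
    qed
  qed (use vec.span_zero in auto)
qed

lemma kernel_E_inter_range_F: "{x. E x = 0} \<inter> range F \<subseteq> {0}"
proof
  fix x assume "x \<in> {x. E x = 0} \<inter> range F"
  then obtain y where "E x = 0" "x = F y" by auto
  then have "ip x x = 0" using ip_F_adjoint[of y x] by simp
  then show "x \<in> {0}" by simp
qed

text \<open>
  The sum is direct because ker E is orthogonal to im F; rank-nullity for E on X and for F on Y
  then leaves no room for a proper subspace.
\<close>
lemma subspace_eq_kernel_E_plus_image_F:
  assumes X: "vec.subspace X" and Y: "vec.subspace Y" and "E ` X \<subseteq> Y" "F ` Y \<subseteq> X"
  shows "X = (X \<inter> {x. E x = 0}) + F ` Y"
proof -
  interpret mirror: hermitian_sl2 F E "\<lambda>x. - H x" ip by (rule mirror)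
  have KX: "vec.subspace (X \<inter> {x. E x = 0})" using X E.subspace_kernel by (rule vec.subspace_inter)
  have KY: "vec.subspace (Y \<inter> {x. F x = 0})" using Y F.subspace_kernel by (rule vec.subspace_inter)
  have FY: "vec.subspace (F ` Y)" using F.subspace_image[OF Y] .
  have EX: "vec.subspace (E ` X)" using E.subspace_image[OF X] .
  have "vec.dim ((X \<inter> {x. E x = 0}) + F ` Y) = vec.dim (X \<inter> {x. E x = 0}) + vec.dim (F ` Y)"
    using kernel_E_inter_range_F by (intro vec.dim_set_plus_disjoint[OF KX FY]) auto
  moreover have "vec.dim ((Y \<inter> {x. F x = 0}) + E ` X) = vec.dim (Y \<inter> {x. F x = 0}) + vec.dim (E ` X)"
    using mirror.kernel_E_inter_range_F by (intro vec.dim_set_plus_disjoint[OF KY EX]) auto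
  moreover have sub: "(X \<inter> {x. E x = 0}) + F ` Y \<subseteq> X" "(Y \<inter> {x. F x = 0}) + E ` X \<subseteq> Y"
    using assms by (auto simp: set_plus_def intro: vec.subspace_add)
  moreover note vec.dim_subset[OF sub(1)] vec.dim_subset[OF sub(2)]
  ultimately have "vec.dim ((X \<inter> {x. E x = 0}) + F ` Y) = vec.dim X"
    using vec.rank_nullity[OF E.linear_axioms X] vec.rank_nullity[OF F.linear_axioms Y] by linarith
  then show ?thesis
    using vec.subspace_dim_equal[OF vec.subspace_set_plus[OF KX FY] X sub(1)] by simp
qed

lemma kernel_E_eq_span_primitive:
  "{x. E x = 0} = vec.span (\<Union>j<CARD('n). primitive_space (of_nat j))"
  (is "?K = vec.span ?P")
proof
  have "H x \<in> ?K" if "x \<in> ?K" for x using that H_E[of x] by simp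
  then have "?K \<subseteq> vec.span (\<Union>c. ?K \<inter> weight_space c)"
    by (intro invariant_subspace_spanned_by_weight_vectors E.subspace_kernel) auto
  also have "\<dots> \<subseteq> vec.span ?P"
  proof (rule vec.span_minimal[OF _ vec.subspace_span], rule subsetI)
    fix x assume "x \<in> (\<Union>c. ?K \<inter> weight_space c)"
    then obtain c where c: "x \<in> primitive_space c" unfolding primitive_space_eq by auto
    show "x \<in> vec.span ?P"
    proof (cases "x = 0")
      case False
      then obtain j where "c = of_nat j" "j < CARD('n)"
        using primitive_weight_nat c by blast
      with c show ?thesis by (metis (no_types, lifting) UN_I lessThan_iff vec.span_base)
    qed (simp add: vec.span_zero)
  qed
  finally show "?K \<subseteq> vec.span ?P" .
  show "vec.span ?P \<subseteq> ?K"
    by (rule vec.span_minimal[OF _ E.subspace_kernel]) (auto simp: primitive_space_def)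
qed

lemma dim_weight_space_recursion:
  "vec.dim (weight_space (of_nat j)) =
     vec.dim (primitive_space (of_nat j)) + vec.dim (weight_space (of_nat (j + 2)))"
proof -
  let ?X = "weight_space (of_nat j)" and ?Y = "weight_space (of_nat (j + 2))"
  have "E ` ?X \<subseteq> ?Y" by (auto simp: weight_space_def H_E E.scale vector_sadd_rdistrib)
  moreover have "F ` ?Y \<subseteq> ?X"
  proof
    fix y assume "y \<in> F ` ?Y"
    then obtain x where "H x = of_nat (j + 2) *s x" "y = F x" by (auto simp: weight_space_def)
    then show "y \<in> ?X" by (simp add: weight_space_def H_F F.add F.scale)
  qed
  ultimately have X: "?X = primitive_space (of_nat j) + F ` ?Y"
    using subspace_eq_kernel_E_plus_image_F[OF weight_space_subspace weight_space_subspace]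
    by (simp add: primitive_space_eq Int_commute)
  have "inj_on F ?Y"
    unfolding F.inj_on_iff_eq_0[OF weight_space_subspace]
    using F_eq_0_pos_weight[of _ "j + 2"] by (simp add: weight_space_def)
  then have "vec.dim (F ` ?Y) = vec.dim ?Y"
    using vec.dim_image_eq[OF F.linear_axioms, of ?Y] vec.span_eq_iff[THEN iffD2, OF weight_space_subspace]
    by simp
  moreover have "primitive_space (of_nat j) \<inter> F ` ?Y \<subseteq> {0}"
    using kernel_E_inter_range_F by (auto simp: primitive_space_def)
  ultimately show ?thesis
    by (subst X) (simp add: vec.dim_set_plus_disjoint primitive_space_subspace F.subspace_image weight_space_subspace)
qed

lemma dim_weight_space_0:
  "vec.dim (weight_space 0) = (\<Sum>k<CARD('n). vec.dim (primitive_space (of_nat (2 * k))))"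
proof -
  define d where "d = CARD('n)"
  have "vec.dim (weight_space (of_nat (2 * i))) = (\<Sum>k\<in>{i..<d}. vec.dim (primitive_space (of_nat (2 * k))))"
    if "i \<le> d" for i
    using that
  proof (induction i rule: inc_induct)
    case base
    have "weight_space (of_nat (2 * d)) \<subseteq> {0}" by (rule weight_space_trivial) (simp add: d_def)
    then show ?case by simp
  next
    case (step i)
    then show ?case
      using dim_weight_space_recursion[of "2 * i"] by (simp add: sum.atLeast_Suc_lessThan)
  qed
  from this[of 0] show ?thesis by (simp add: d_def atLeast0LessThan)
qed

end

section \<open>An involution anticommuting with E and F\<close>

lemma sum_lessThan_even:
  fixes f :: "nat \<Rightarrow> 'a::comm_monoid_add"
  shows "(\<Sum>j<2 * n. if even j then f j else 0) = (\<Sum>k<n. f (2 * k))"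
  by (induction n) (simp_all add: lessThan_Suc)

locale hermitian_sl2_involution = hermitian_sl2 E F H ip +
  sg: Vector_Spaces.linear "(*s) :: complex \<Rightarrow> 'n cvec \<Rightarrow> 'n cvec" "(*s)" sg
  for E F H :: "'n::finite cvec \<Rightarrow> 'n cvec" and ip and sg +
  assumes sg_sg: "\<And>x. sg (sg x) = x"
    and sg_E: "\<And>x. sg (E x) = - E (sg x)"
    and sg_F: "\<And>x. sg (F x) = - F (sg x)"
    and sg_H: "\<And>x. sg (H x) = H (sg x)"
begin

text \<open>For S = UNIV this is dim m - dim h.\<close>
definition sg_excess :: "'n cvec set \<Rightarrow> int" where
  "sg_excess S = int (eigen_dim sg (- 1) S) - int (eigen_dim sg 1 S)"

definition magical :: bool where
  "magical \<longleftrightarrow> primitive_space 0 \<subseteq> {x. sg x = x} \<and>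
     (\<forall>j. even j \<and> 0 < j \<longrightarrow> primitive_space (of_nat j) \<subseteq> {x. sg x = - x})"

lemma mirror_involution: "hermitian_sl2_involution F E (\<lambda>x. - H x) ip sg"
  by (rule hermitian_sl2_involution.intro[OF mirror sg.linear_axioms])
    (unfold_locales, simp_all add: sg_sg sg_E sg_F sg_H sg.neg)

lemma sg_funpow_F: "sg ((F ^^ k) x) = (- 1) ^ k *s (F ^^ k) (sg x)"
proof (induction k)
  case (Suc k)
  then have "sg ((F ^^ Suc k) x) = - F ((- 1) ^ k *s (F ^^ k) (sg x))" by (simp add: sg_F)
  then show ?case by (simp add: F.scale vec_eq_iff)
qed simp

lemma sg_stable_kernel_E: "sg ` {x. E x = 0} \<subseteq> {x. E x = 0}"
proof (rule image_subsetI)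
  fix x assume "x \<in> {x. E x = 0}"
  then show "sg x \<in> {x. E x = 0}" using sg_E[of x] by simp
qed

lemma sg_stable_range_F: "sg ` range F \<subseteq> range F"
proof (rule image_subsetI)
  fix y assume "y \<in> range F"
  then obtain x where "y = F x" by blast
  then have "sg y = F (- sg x)" by (simp add: sg_F F.neg)
  then show "sg y \<in> range F" by simp
qed

lemma sg_stable_primitive_space: "sg ` primitive_space c \<subseteq> primitive_space c"
  using sg_stable_kernel_E by (auto simp: primitive_space_def sg_H[symmetric] sg.scale)

lemma sg_stable_span: "sg ` S \<subseteq> S \<Longrightarrow> sg ` vec.span S \<subseteq> vec.span S"
  using vec.span_mono[of "sg ` S" S] sg.span_image[of S] by simp

lemma sg_excess_set_plus:
  assumes "vec.subspace P" "sg ` P \<subseteq> P" "vec.subspace Q" "sg ` Q \<subseteq> Q" "P \<inter> Q \<subseteq> {0}"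
  shows "sg_excess (P + Q) = sg_excess P + sg_excess Q"
  using eigen_dim_set_plus[OF sg.linear_axioms assms] by (simp add: sg_excess_def)

lemma sg_excess_span_primitive_spaces:
  assumes "finite L"
  shows "sg_excess (vec.span (\<Union>c\<in>L. primitive_space c)) = (\<Sum>c\<in>L. sg_excess (primitive_space c))"
  using assms
proof (induction L rule: finite_induct)
  case empty
  then show ?case by (simp add: sg_excess_def eigen_dim_trivial vec.span_empty)
next
  case (insert a L)
  let ?U = "vec.span (\<Union>c\<in>L. primitive_space c)"
  have "vec.span (\<Union>c\<in>insert a L. primitive_space c) = primitive_space a + ?U"
    using vec.span_Un_set_plus[of "primitive_space a"] vec.span_eq_iff[THEN iffD2, OF primitive_space_subspace]
    by simp
  moreover have "primitive_space a \<inter> ?U \<subseteq> {0}"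
  proof
    fix x assume x: "x \<in> primitive_space a \<inter> ?U"
    have "?U \<subseteq> {y. ip y x = 0}"
    proof (rule vec.span_minimal)
      show "(\<Union>c\<in>L. primitive_space c) \<subseteq> {y. ip y x = 0}"
        using x insert.hyps(2) ip_weight_vectors_orthogonal by (fastforce simp: primitive_space_def)
      show "vec.subspace {y. ip y x = 0}"
        by (auto simp: vec.subspace_def ip_add_left ip_scale_left)
    qed
    then show "x \<in> {0}" using x by auto
  qed
  moreover have "sg ` ?U \<subseteq> ?U"
    using sg_stable_primitive_space by (intro sg_stable_span) blast
  ultimately show ?case
    using insert sg_excess_set_plus[OF primitive_space_subspace sg_stable_primitive_space vec.subspace_span]
    by simp
qed

lemma sg_excess_kernel_E:
  "sg_excess {x. E x = 0} = (\<Sum>j<CARD('n). sg_excess (primitive_space (of_nat j)))"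
proof -
  have "inj_on (of_nat :: nat \<Rightarrow> complex) A" for A by (rule inj_onI) simp
  then show ?thesis
    using sg_excess_span_primitive_spaces[of "of_nat ` {..<CARD('n)}"]
    by (simp add: kernel_E_eq_span_primitive[simplified UN_simps] sum.reindex image_UN)
qed

text \<open>F maps the (- s)-eigenvectors of sg in Y onto the s-eigenvectors in F ` Y.\<close>
lemma eigen_dim_image_F:
  assumes Y: "vec.subspace Y" "sg ` Y \<subseteq> Y" and s: "s \<in> {1, - 1}"
  shows "eigen_dim sg s (F ` Y) + eigen_dim sg (- s) (Y \<inter> {x. F x = 0}) = eigen_dim sg (- s) Y"
proof -
  let ?M = "Y \<inter> {x. sg x = (- s) *s x}"
  have M: "vec.subspace ?M" using Y(1) eigenspace_subspace[OF sg.linear_axioms] by (rule vec.subspace_inter)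
  have "F ` Y \<inter> {x. sg x = s *s x} = F ` ?M"
  proof
    show "F ` ?M \<subseteq> F ` Y \<inter> {x. sg x = s *s x}"
      using sg_F by (auto simp: F.scale F.neg)
    show "F ` Y \<inter> {x. sg x = s *s x} \<subseteq> F ` ?M"
    proof
      fix z assume "z \<in> F ` Y \<inter> {x. sg x = s *s x}"
      then obtain y where y: "y \<in> Y" "z = F y" "sg (F y) = s *s F y" by auto
      define y' where "y' = (1/2) *s (y - s *s sg y)"
      have "y' \<in> Y"
        using Y y(1) by (simp add: y'_def image_subset_iff vec.subspace_diff vec.subspace_scale)
      moreover have "sg y' = (- s) *s y'"
        using s by (auto simp: y'_def sg.scale sg.diff sg_sg vec_eq_iff algebra_simps)
      moreover have "F (sg y) = - (s *s F y)" using sg_F[of y] y(3) by simp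
      then have "F y' = z"
        using s y(2) by (simp add: y'_def F.scale F.diff) (auto simp: vec_eq_iff field_simps)
      ultimately show "z \<in> F ` ?M" by blast
    qed
  qed
  moreover have "?M \<inter> {x. F x = 0} = (Y \<inter> {x. F x = 0}) \<inter> {x. sg x = (- s) *s x}" by blast
  ultimately show ?thesis
    using vec.rank_nullity[OF F.linear_axioms M] by (simp add: eigen_dim_def)
qed

lemma double_sg_excess_UNIV:
  "2 * sg_excess UNIV = sg_excess {x. E x = 0} + sg_excess {x. F x = 0}"
proof -
  have "UNIV = {x. E x = 0} + range F"
    using subspace_eq_kernel_E_plus_image_F[OF vec.subspace_UNIV vec.subspace_UNIV] by simp
  then have "sg_excess UNIV = sg_excess {x. E x = 0} + sg_excess (range F)"
    using sg_excess_set_plus[OF E.subspace_kernel sg_stable_kernel_E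
        F.subspace_image[OF vec.subspace_UNIV] sg_stable_range_F kernel_E_inter_range_F]
    by simp
  moreover have "sg_excess (range F) = sg_excess {x. F x = 0} - sg_excess UNIV"
  proof -
    have "int (eigen_dim sg s (range F)) + int (eigen_dim sg (- s) {x. F x = 0}) = int (eigen_dim sg (- s) UNIV)"
      if "s \<in> {1, - 1}" for s
      using eigen_dim_image_F[OF vec.subspace_UNIV _ that] by (simp flip: of_nat_add)
    from this[of 1] this[of "- 1"] show ?thesis unfolding sg_excess_def by simp
  qed
  ultimately show ?thesis by simp
qed

lemma eigen_dim_primitive_le_lowest:
  "eigen_dim sg s (primitive_space (of_nat j))
     \<le> eigen_dim sg ((- 1) ^ j * s) (lowest_weight_space (of_nat j))"
  unfolding eigen_dim_def
proof (rule vec.dim_le_of_inj_on[OF clinear_funpow[OF F.linear_axioms, of j]])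
  let ?P = "primitive_space (of_nat j) \<inter> {x. sg x = s *s x}"
  show "vec.subspace ?P"
    using primitive_space_subspace eigenspace_subspace[OF sg.linear_axioms] by (rule vec.subspace_inter)
  show "inj_on (F ^^ j) ?P"
    using vec.linear_inj_on_iff_eq_0[OF clinear_funpow[OF F.linear_axioms] \<open>vec.subspace ?P\<close>]
      funpow_F_primitive_neq_0[of _ "of_nat j" j] by auto
  show "(F ^^ j) ` ?P \<subseteq> lowest_weight_space (of_nat j) \<inter> {x. sg x = ((- 1) ^ j * s) *s x}"
  proof clarify
    fix x assume x: "x \<in> primitive_space (of_nat j)" "sg x = s *s x"
    have "F ((F ^^ j) x) = 0" using funpow_F_primitive_eq_0[OF x(1)] by simp
    moreover have "H ((F ^^ j) x) = - (of_nat j *s (F ^^ j) x)"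
      using H_funpow_F[of x "of_nat j" j] x(1) by (simp add: primitive_space_def vec_eq_iff)
    moreover have "sg ((F ^^ j) x) = ((- 1) ^ j * s) *s (F ^^ j) x"
      using x(2) by (simp add: sg_funpow_F vec.linear_scale[OF clinear_funpow[OF F.linear_axioms]])
    ultimately show "(F ^^ j) x \<in> lowest_weight_space (of_nat j) \<inter> {x. sg x = ((- 1) ^ j * s) *s x}"
      by (simp add: hermitian_sl2.primitive_space_def[OF mirror])
  qed
qed

text \<open>
  F ^^ j maps V_j isomorphically onto the lowest weight vectors of weight - j and multiplies the
  eigenvalues of sg by (- 1) ^ j.
\<close>
lemma sg_excess_lowest_weight:
  "sg_excess (lowest_weight_space (of_nat j))
     = (- 1) ^ j * sg_excess (primitive_space (of_nat j))"
proof -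
  interpret mirror: hermitian_sl2_involution F E "\<lambda>x. - H x" ip sg by (rule mirror_involution)
  let ?P = "primitive_space (of_nat j)" and ?L = "mirror.primitive_space (of_nat j)"
  have le: "eigen_dim sg s ?L \<le> eigen_dim sg ((- 1) ^ j * s) ?P"
    "eigen_dim sg s ?P \<le> eigen_dim sg ((- 1) ^ j * s) ?L" for s
    using mirror.eigen_dim_primitive_le_lowest[of s j] eigen_dim_primitive_le_lowest[of s j]
    by (simp_all add: primitive_space_def hermitian_sl2.primitive_space_def[OF mirror.mirror])
  show ?thesis
  proof (cases "even j")
    case True
    then have "eigen_dim sg s ?L = eigen_dim sg s ?P" for s
      using le[of s] by (simp add: antisym)
    then show ?thesis using True by (simp add: sg_excess_def)
  next
    case False
    then have "eigen_dim sg s ?L = eigen_dim sg (- s) ?P" for s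
      using le[of s] le[of "- s"] by (simp add: antisym)
    then show ?thesis using False by (simp add: sg_excess_def)
  qed
qed

lemma sg_excess_UNIV_eq_sum_primitive:
  "sg_excess UNIV = (\<Sum>k<CARD('n). sg_excess (primitive_space (of_nat (2 * k))))"
proof -
  interpret mirror: hermitian_sl2_involution F E "\<lambda>x. - H x" ip sg by (rule mirror_involution)
  define t where "t j = sg_excess (primitive_space (of_nat j))" for j
  have "2 * sg_excess UNIV = (\<Sum>j<CARD('n). t j + (- 1) ^ j * t j)"
    using double_sg_excess_UNIV sg_excess_kernel_E mirror.sg_excess_kernel_E
    by (simp add: t_def sg_excess_lowest_weight sum.distrib card_cart_basis)
  also have "\<dots> = 2 * (\<Sum>j<2 * CARD('n). if even j then t j else 0)"
  proof -
    have "t j = 0" if "CARD('n) \<le> j" for j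
      using primitive_space_trivial[of j] that by (simp add: t_def sg_excess_def eigen_dim_trivial card_cart_basis)
    then have "(\<Sum>j<2 * CARD('n). if even j then t j else 0) = (\<Sum>j<CARD('n). if even j then t j else 0)"
      by (intro sum.mono_neutral_right) auto
    then show ?thesis by (simp add: sum_distrib_left) (rule sum.cong, auto)
  qed
  finally show ?thesis by (simp add: sum_lessThan_even t_def)
qed

lemma magical_iff_dimension_identity:
  "magical \<longleftrightarrow> primitive_space 0 \<subseteq> {x. sg x = x} \<and>
     sg_excess UNIV = int (vec.dim (weight_space 0)) - 2 * int (vec.dim (primitive_space 0))"
proof -
  define V where "V k = primitive_space (of_nat (2 * k))" for k
  define p where "p k = eigen_dim sg 1 (V k)" for k
  define q where "q k = eigen_dim sg (- 1) (V k)" for k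
  have V: "vec.subspace (V k)" "sg ` V k \<subseteq> V k" for k
    unfolding V_def by (rule primitive_space_subspace sg_stable_primitive_space)+
  have V_0: "V 0 = primitive_space 0" by (simp add: V_def)
  have centralizer_iff: "primitive_space 0 \<subseteq> {x. sg x = x} \<longleftrightarrow> q 0 = 0"
    using subset_eigenspace_iff[OF sg.linear_axioms sg_sg V, of 1 0] V_0 by (simp add: q_def)
  have primitive_iff: "V k \<subseteq> {x. sg x = - x} \<longleftrightarrow> p k = 0" for k
    using subset_eigenspace_iff[OF sg.linear_axioms sg_sg V, of "- 1" k]
    by (simp add: p_def vector_sneg_minus1[symmetric])
  have magical_iff: "magical \<longleftrightarrow> q 0 = 0 \<and> (\<forall>k\<in>{1..<CARD('n)}. p k = 0)"
  proof -
    have "(\<forall>j. even j \<and> 0 < j \<longrightarrow> primitive_space (of_nat j) \<subseteq> {x. sg x = - x}) \<longleftrightarrow>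
        (\<forall>k. 0 < k \<longrightarrow> V k \<subseteq> {x. sg x = - x})"
    proof (intro iffI allI impI)
      fix k :: nat assume "\<forall>j. even j \<and> 0 < j \<longrightarrow> primitive_space (of_nat j) \<subseteq> {x. sg x = - x}"
        and "0 < k"
      then show "V k \<subseteq> {x. sg x = - x}"
        unfolding V_def by (metis dvd_triv_left mult_pos_pos zero_less_numeral)
    next
      fix j :: nat assume V_minus: "\<forall>k. 0 < k \<longrightarrow> V k \<subseteq> {x. sg x = - x}" and "even j \<and> 0 < j"
      then obtain k where "j = 2 * k" "0 < k" by (auto elim!: evenE)
      then show "primitive_space (of_nat j) \<subseteq> {x. sg x = - x}"
        using V_minus unfolding V_def by blast
    qed
    also have "\<dots> \<longleftrightarrow> (\<forall>k\<in>{1..<CARD('n)}. p k = 0)"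
    proof (intro iffI allI impI ballI)
      fix k assume "\<forall>k. 0 < k \<longrightarrow> V k \<subseteq> {x. sg x = - x}" and "k \<in> {1..<CARD('n)}"
      then show "p k = 0" using primitive_iff by simp
    next
      fix k :: nat assume p: "\<forall>k\<in>{1..<CARD('n)}. p k = 0" and "0 < k"
      show "V k \<subseteq> {x. sg x = - x}"
      proof (cases "k < CARD('n)")
        case True
        then show ?thesis using p \<open>0 < k\<close> primitive_iff by simp
      next
        case False
        then show ?thesis using primitive_space_trivial[of "2 * k"] by (auto simp: V_def)
      qed
    qed
    finally show ?thesis using centralizer_iff by (simp add: magical_def)
  qed
  have dim_V: "vec.dim (V k) = p k + q k" for k
    unfolding p_def q_def by (rule dim_eq_eigen_dim_plus_minus[OF sg.linear_axioms sg_sg V])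
  have split_0: "(\<Sum>k<CARD('n). g k) = g 0 + (\<Sum>k\<in>{1..<CARD('n)}. g k)" for g :: "nat \<Rightarrow> int"
    by (simp add: atLeast0LessThan[symmetric] sum.atLeast_Suc_lessThan)
  have "sg_excess UNIV = (\<Sum>k<CARD('n). int (q k) - int (p k))"
    using sg_excess_UNIV_eq_sum_primitive unfolding V_def[symmetric] by (simp add: sg_excess_def p_def q_def)
  then have excess: "sg_excess UNIV = int (q 0) - int (p 0)
      + (\<Sum>k\<in>{1..<CARD('n)}. int (q k)) - (\<Sum>k\<in>{1..<CARD('n)}. int (p k))"
    by (simp add: split_0 sum_subtractf)
  have "int (vec.dim (weight_space 0)) = (\<Sum>k<CARD('n). int (p k) + int (q k))"
    using dim_weight_space_0 unfolding V_def[symmetric] by (simp add: dim_V of_nat_sum)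
  then have G0: "int (vec.dim (weight_space 0)) = int (p 0) + int (q 0)
      + (\<Sum>k\<in>{1..<CARD('n)}. int (p k)) + (\<Sum>k\<in>{1..<CARD('n)}. int (q k))"
    by (simp add: split_0 sum.distrib)
  have "int (vec.dim (primitive_space 0)) = int (p 0) + int (q 0)"
    using dim_V[of 0] V_0 by simp
  with excess G0 have "sg_excess UNIV - (int (vec.dim (weight_space 0)) - 2 * int (vec.dim (primitive_space 0)))
      = 2 * int (q 0) - 2 * (\<Sum>k\<in>{1..<CARD('n)}. int (p k))"
    by simp
  moreover have "(\<Sum>k\<in>{1..<CARD('n)}. int (p k)) = 0 \<longleftrightarrow> (\<forall>k\<in>{1..<CARD('n)}. p k = 0)"
    by (simp add: sum_nonneg_eq_0_iff)
  ultimately show ?thesis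
    using centralizer_iff magical_iff by auto
qed

end

section \<open>The Killing form\<close>

lemma clinear_eq_sum_axis:
  assumes "clinear A"
  shows "A x = (\<Sum>k\<in>UNIV. x $ k *s A (axis k 1))"
proof -
  have "A x = A (\<Sum>k\<in>UNIV. x $ k *s axis k 1)" by (simp add: basis_expansion)
  then show ?thesis by (simp add: vec.linear_sum[OF assms] vec.linear_scale[OF assms])
qed

lemma ctrace_commute:
  assumes "clinear A" "clinear C"
  shows "ctrace (\<lambda>z. A (C z)) = ctrace (\<lambda>z. C (A z))"
proof -
  have "ctrace (\<lambda>z. A (C z)) = (\<Sum>i\<in>UNIV. \<Sum>k\<in>UNIV. C (axis i 1) $ k * A (axis k 1) $ i)"
    unfolding ctrace_def by (subst clinear_eq_sum_axis[OF assms(1)]) simp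
  also have "\<dots> = (\<Sum>k\<in>UNIV. \<Sum>i\<in>UNIV. C (axis i 1) $ k * A (axis k 1) $ i)"
    by (rule sum.swap)
  also have "\<dots> = ctrace (\<lambda>z. C (A z))"
    unfolding ctrace_def by (subst clinear_eq_sum_axis[OF assms(2)]) (simp add: mult.commute)
  finally show ?thesis .
qed

lemma ctrace_add: "ctrace (\<lambda>z. A z + C z) = ctrace A + ctrace C"
  unfolding ctrace_def by (simp add: sum.distrib)

lemma ctrace_diff: "ctrace (\<lambda>z. A z - C z) = ctrace A - ctrace C"
  unfolding ctrace_def by (simp add: sum_subtractf)

lemma ctrace_scale: "ctrace (\<lambda>z. c *s A z) = c * ctrace A"
  unfolding ctrace_def by (simp add: sum_distrib_left)

locale complex_lie_algebra =
  fixes br :: "'n::finite cvec \<Rightarrow> 'n cvec \<Rightarrow> 'n cvec"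
  assumes lie_algebra: "lie_algebra br"
begin

lemma clinear_bracket_right: "clinear (br x)"
  using lie_algebra unfolding lie_algebra_def by blast

lemma clinear_bracket_left: "clinear (\<lambda>x. br x y)"
  using lie_algebra unfolding lie_algebra_def by blast

lemma bracket_self [simp]: "br x x = 0"
  using lie_algebra unfolding lie_algebra_def by blast

lemma jacobi: "br x (br y z) + br y (br z x) + br z (br x y) = 0"
  using lie_algebra unfolding lie_algebra_def by blast

lemmas bracket_left = vec.linear_add[OF clinear_bracket_left] vec.linear_scale[OF clinear_bracket_left]
  vec.linear_diff[OF clinear_bracket_left] vec.linear_neg[OF clinear_bracket_left]

lemmas bracket_right = vec.linear_add[OF clinear_bracket_right] vec.linear_scale[OF clinear_bracket_right]
  vec.linear_diff[OF clinear_bracket_right] vec.linear_neg[OF clinear_bracket_right]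

lemma bracket_antisym: "br y x = - br x y"
proof -
  have "br (x + y) (x + y) = br x y + br y x"
    by (simp only: bracket_left bracket_right) simp
  then show ?thesis by (simp add: eq_neg_iff_add_eq_0 add.commute)
qed

lemma bracket_bracket_left: "br (br a b) z = br a (br b z) - br b (br a z)"
  using jacobi[of a b z] bracket_antisym[of "br a b" z] bracket_antisym[of z a]
  by (simp add: bracket_right algebra_simps)

lemma killing_add_left: "killing br (x + x') y = killing br x y + killing br x' y"
  unfolding killing_def by (simp add: bracket_left ctrace_add)

lemma killing_scale_left: "killing br (c *s x) y = c * killing br x y"
  unfolding killing_def by (simp add: bracket_left ctrace_scale)

lemma killing_add_right: "killing br x (y + y') = killing br x y + killing br x y'"
  unfolding killing_def by (simp add: bracket_left bracket_right ctrace_add)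

lemma killing_scale_right: "killing br x (c *s y) = c * killing br x y"
  unfolding killing_def by (simp add: bracket_left bracket_right ctrace_scale)

lemma killing_zero_left [simp]: "killing br 0 y = 0"
  using killing_scale_left[of 0 0 y] by simp

lemma killing_neg_right: "killing br x (- y) = - killing br x y"
  using killing_scale_right[of x "- 1" y] by (simp add: vector_sneg_minus1[symmetric])

lemma killing_commute: "killing br x y = killing br y x"
  unfolding killing_def by (rule ctrace_commute[OF clinear_bracket_right clinear_bracket_right])

lemma clinear_bracket_bracket: "clinear (\<lambda>w. br x (br y w))"
  using Vector_Spaces.linear_compose[OF clinear_bracket_right clinear_bracket_right] by (simp add: comp_def)

lemma killing_bracket: "killing br (br z x) y = - killing br x (br z y)"
proof -
  have "killing br (br z x) y = ctrace (\<lambda>w. br z (br x (br y w))) - ctrace (\<lambda>w. br x (br z (br y w)))"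
    unfolding killing_def bracket_bracket_left by (rule ctrace_diff)
  moreover have "killing br x (br z y) = ctrace (\<lambda>w. br x (br z (br y w))) - ctrace (\<lambda>w. br x (br y (br z w)))"
    unfolding killing_def bracket_bracket_left bracket_right by (rule ctrace_diff)
  moreover have "ctrace (\<lambda>w. br z (br x (br y w))) = ctrace (\<lambda>w. br x (br y (br z w)))"
    using ctrace_commute[OF clinear_bracket_right clinear_bracket_bracket, of z x y] by simp
  ultimately show ?thesis by simp
qed

lemma killing_automorphism:
  assumes "lie_automorphism br s" "\<And>x. s (s x) = x"
  shows "killing br (s x) (s y) = killing br x y"
proof -
  have s: "clinear s" and hom: "\<And>x y. s (br x y) = br (s x) (s y)"
    using assms(1) by (auto simp: lie_automorphism_def)
  have ad: "br (s x) w = s (br x (s w))" for x w using hom[of x "s w"] assms(2) by simp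
  have "clinear (\<lambda>w. br x (br y (s w)))"
    using Vector_Spaces.linear_compose[OF s clinear_bracket_bracket] by (simp add: comp_def)
  then have "ctrace (\<lambda>w. s (br x (br y (s w)))) = ctrace (\<lambda>w. br x (br y (s (s w))))"
    using ctrace_commute[OF s] by blast
  then show ?thesis unfolding killing_def ad assms(2) .
qed

end

section \<open>The Cayley transform of a real sl2-triple\<close>

locale real_cayley_triple = complex_lie_algebra br for br :: "'n::finite cvec \<Rightarrow> 'n cvec \<Rightarrow> 'n cvec" +
  fixes tau sg :: "'n cvec \<Rightarrow> 'n cvec" and eh hh fh :: "'n cvec"
  assumes real_form_conj: "real_form_conj br tau"
    and cartan_involution: "complexified_cartan_involution br tau sg"
    and real_eh: "eh \<in> real_form tau" and real_hh: "hh \<in> real_form tau" and real_fh: "fh \<in> real_form tau"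
    and real_triple: "sl2_triple br eh hh fh"
    and sg_eh: "sg eh = - fh" and sg_hh: "sg hh = - hh"
begin

abbreviation "e \<equiv> cayley_e eh hh fh"
abbreviation "h \<equiv> cayley_h eh hh fh"
abbreviation "f \<equiv> cayley_f eh hh fh"

text \<open>The conjugation of g with respect to the compact real form h^R + i m^R.\<close>
definition theta :: "'n cvec \<Rightarrow> 'n cvec" where
  "theta x = sg (tau x)"

definition herm :: "'n cvec \<Rightarrow> 'n cvec \<Rightarrow> complex" where
  "herm x y = - killing br x (theta y)"

lemma tau_add: "tau (x + y) = tau x + tau y"
  and tau_scale: "tau (c *s x) = cnj c *s tau x"
  and tau_tau: "tau (tau x) = x"
  and tau_bracket: "tau (br x y) = br (tau x) (tau y)"
  using real_form_conj unfolding real_form_conj_def by blast+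

lemma tau_neg: "tau (- x) = - tau x"
  using tau_scale[of "- 1" x] by (simp add: vector_sneg_minus1[symmetric])

lemma tau_diff: "tau (x - y) = tau x - tau y"
  using tau_add[of x "- y"] by (simp add: tau_neg)

lemma clinear_sg: "clinear sg"
  and sg_bracket: "sg (br x y) = br (sg x) (sg y)"
  and sg_sg: "sg (sg x) = x"
  and tau_sg: "tau (sg x) = sg (tau x)"
  using cartan_involution by (auto simp: complexified_cartan_involution_def lie_automorphism_def)

lemma killing_sg_negative:
  "x \<in> real_form tau \<Longrightarrow> x \<noteq> 0 \<Longrightarrow> Im (killing br x (sg x)) = 0 \<and> Re (killing br x (sg x)) < 0"
  using cartan_involution unfolding complexified_cartan_involution_def by blast

lemmas sg_linear = vec.linear_add[OF clinear_sg] vec.linear_scale[OF clinear_sg]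
  vec.linear_diff[OF clinear_sg] vec.linear_neg[OF clinear_sg]

lemma sg_fh: "sg fh = - eh"
  using sg_sg[of eh] by (simp add: sg_eh sg_linear) (metis minus_minus)

lemma tau_triple: "tau eh = eh" "tau hh = hh" "tau fh = fh"
  using real_eh real_hh real_fh by (simp_all add: real_form_def)

lemma bracket_triple:
  "br hh eh = 2 *s eh" "br hh fh = - (2 *s fh)" "br eh fh = hh"
  "br eh hh = - (2 *s eh)" "br fh hh = 2 *s fh" "br fh eh = - hh"
  using real_triple bracket_antisym[of eh hh] bracket_antisym[of fh hh] bracket_antisym[of fh eh]
  by (simp_all add: sl2_triple_def)

lemma cayley_triple: "br h e = 2 *s e" "br h f = - (2 *s f)" "br e f = h"
  by (simp_all add: cayley_h_def cayley_e_def cayley_f_def bracket_left bracket_right bracket_triple)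
    (simp_all add: vec_eq_iff algebra_simps)

lemma sg_cayley: "sg e = - e" "sg h = h" "sg f = - f"
  by (simp_all add: cayley_h_def cayley_e_def cayley_f_def sg_linear sg_eh sg_fh sg_hh)

lemma theta_cayley: "theta e = - f" "theta h = - h" "theta f = - e"
  by (simp_all add: theta_def cayley_h_def cayley_e_def cayley_f_def tau_add tau_diff tau_scale tau_triple
      sg_linear sg_eh sg_fh sg_hh)

lemma theta_add: "theta (x + y) = theta x + theta y"
  and theta_scale: "theta (c *s x) = cnj c *s theta x"
  and theta_neg: "theta (- x) = - theta x"
  and theta_theta: "theta (theta x) = x"
  and theta_bracket: "theta (br x y) = br (theta x) (theta y)"
  by (simp_all add: theta_def tau_add tau_scale tau_neg sg_linear tau_sg[symmetric] tau_tau sg_sg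
      tau_bracket sg_bracket)

lemma herm_add_left: "herm (x + y) z = herm x z + herm y z"
  and herm_scale_left: "herm (c *s x) z = c * herm x z"
  and herm_add_right: "herm z (x + y) = herm z x + herm z y"
  and herm_scale_right: "herm z (c *s x) = cnj c * herm z x"
  and herm_neg_right: "herm z (- x) = - herm z x"
  by (simp_all add: herm_def killing_add_left killing_scale_left killing_add_right killing_scale_right
      killing_neg_right theta_add theta_scale theta_neg)

lemma herm_bracket: "herm (br z x) y = - herm x (br (theta z) y)"
  unfolding herm_def killing_bracket theta_bracket theta_theta by simp

text \<open>
  Write x = a + i b with a, b in the real form; the cross terms cancel because
  B(a, sigma b) = B(b, sigma a).
\<close>
lemma herm_self_pos:
  assumes "x \<noteq> 0"
  shows "Re (herm x x) > 0"
proof -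
  define a where "a = (1/2) *s (x + tau x)"
  define b where "b = (- \<i> / 2) *s (x - tau x)"
  have "a \<in> real_form tau" "b \<in> real_form tau"
    by (simp_all add: real_form_def a_def b_def tau_scale tau_add tau_diff tau_tau vec_eq_iff algebra_simps)
  have x: "x = a + \<i> *s b" and "theta x = sg a - \<i> *s sg b"
    by (simp_all add: a_def b_def theta_def sg_linear tau_scale tau_add tau_diff tau_tau vec_eq_iff field_simps)
  have "killing br (a + \<i> *s b) (sg a - \<i> *s sg b) =
      killing br a (sg a) + killing br a (- (\<i> *s sg b)) +
      (\<i> * killing br b (sg a) + \<i> * killing br b (- (\<i> *s sg b)))"
    by (simp only: diff_conv_add_uminus killing_add_left killing_add_right killing_scale_left add_ac)
  also have "\<dots> = killing br a (sg a) + killing br b (sg b) + \<i> * (killing br b (sg a) - killing br a (sg b))"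
    by (simp add: killing_neg_right killing_scale_right algebra_simps)
  also have "killing br a (sg b) = killing br b (sg a)"
    using killing_automorphism[of sg b "sg a"] cartan_involution
    by (simp add: complexified_cartan_involution_def sg_sg killing_commute)
  finally have "herm x x = - killing br a (sg a) - killing br b (sg b)"
    using x \<open>theta x = _\<close> by (simp add: herm_def)
  then have "Re (herm x x) = - Re (killing br a (sg a)) - Re (killing br b (sg b))" by simp
  moreover have "a \<noteq> 0 \<or> b \<noteq> 0" using assms x by auto
  ultimately show ?thesis
    using killing_sg_negative[OF \<open>a \<in> real_form tau\<close>] killing_sg_negative[OF \<open>b \<in> real_form tau\<close>]
    by (cases "a = 0"; cases "b = 0") auto
qed

sublocale ad: hermitian_sl2_involution "br e" "br f" "br h" herm sg
proof (rule hermitian_sl2_involution.intro[OF hermitian_sl2.intro])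
  show "clinear (br e)" "clinear (br f)" "clinear (br h)"
    by (rule clinear_bracket_right)+
  show "clinear sg" by (rule clinear_sg)
  show "hermitian_sl2_axioms (br e) (br f) (br h) herm"
  proof
    show "br h (br e x) = br e (br h x) + 2 *s br e x"
      and "br h (br f x) = br f (br h x) - 2 *s br f x"
      and "br e (br f x) = br f (br e x) + br h x" for x
      using bracket_bracket_left[of h e x] bracket_bracket_left[of h f x] bracket_bracket_left[of e f x]
      by (simp_all add: cayley_triple bracket_left algebra_simps)
    show "herm (br e x) y = herm x (br f y)" "herm (br f x) y = herm x (br e y)"
      "herm (br h x) y = herm x (br h y)" for x y
      by (simp_all add: herm_bracket theta_cayley bracket_left herm_neg_right)
  qed (simp_all add: herm_add_left herm_scale_left herm_add_right herm_scale_right herm_self_pos)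
  show "hermitian_sl2_involution_axioms (br e) (br f) (br h) sg"
  proof
    show "sg (br e x) = - br e (sg x)" "sg (br f x) = - br f (sg x)" "sg (br h x) = br h (sg x)" for x
      by (simp_all only: sg_bracket sg_cayley bracket_left)
  qed (rule sg_sg)
qed

lemma centralizer3_eq_primitive_space: "centralizer3 br e h f = ad.primitive_space 0"
  using ad.F_eq_0_weight_0 by (auto simp: centralizer3_def ad.primitive_space_def)

lemma extended_magical_iff_magical: "extended_magical_real br sg eh hh fh \<longleftrightarrow> ad.magical"
proof -
  have V: "hw_space br e h j = ad.primitive_space (of_nat j)" for j
    by (simp add: hw_space_def ad.primitive_space_def)
  have "agrees_with_magical_even br sg e h f \<longleftrightarrow> ad.magical"
  proof
    assume agrees: "agrees_with_magical_even br sg e h f"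
    have sg_primitive: "sg v = (if j = 0 then v else - v)" if "even j" "v \<in> ad.primitive_space (of_nat j)" for j v
    proof -
      have "sg ((br f ^^ 0) v) = (if j = 0 then (br f ^^ 0) v else (- 1) ^ (0 + 1) *s (br f ^^ 0) v)"
        using agrees that unfolding agrees_with_magical_even_def V by blast
      then show ?thesis by (simp add: vector_sneg_minus1[symmetric])
    qed
    have "ad.primitive_space 0 \<subseteq> {x. sg x = x}"
      using sg_primitive[of 0] by auto
    moreover have "ad.primitive_space (of_nat j) \<subseteq> {x. sg x = - x}" if "even j" "0 < j" for j
      using sg_primitive[of j] that by auto
    ultimately show ad.magical by (simp add: ad.magical_def)
  next
    assume magical: ad.magical
    show "agrees_with_magical_even br sg e h f"
      unfolding agrees_with_magical_even_def V
    proof (intro allI impI)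
      fix j k v assume "even j" "k \<le> j" "v \<in> ad.primitive_space (of_nat j)"
      show "sg ((br f ^^ k) v) = (if j = 0 then (br f ^^ k) v else (- 1) ^ (k + 1) *s (br f ^^ k) v)"
      proof (cases "j = 0")
        case True
        then show ?thesis using magical \<open>k \<le> j\<close> \<open>v \<in> _\<close> by (auto simp: ad.magical_def)
      next
        case False
        then have "sg v = - v" using magical \<open>even j\<close> \<open>v \<in> _\<close> by (auto simp: ad.magical_def)
        then show ?thesis
          using False by (simp add: ad.sg_funpow_F vec.linear_neg[OF clinear_funpow[OF ad.F.linear_axioms]])
      qed
    qed
  qed
  then show ?thesis by (simp add: extended_magical_real_def)
qed

end

theorem proposition3p4:
  fixes br :: "'n::finite cvec \<Rightarrow> 'n cvec \<Rightarrow> 'n cvec"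
    and tau sg :: "'n cvec \<Rightarrow> 'n cvec"
    and eh hh fh :: "'n cvec"
  assumes "simple_lie_algebra br"
    and "real_form_conj br tau"
    and "complexified_cartan_involution br tau sg"
    and "eh \<in> real_form tau" and "hh \<in> real_form tau" and "fh \<in> real_form tau"
    and "sl2_triple br eh hh fh"
    and "sg eh = - fh" and "sg hh = - hh"
  shows "(extended_magical_real br sg eh hh fh \<longleftrightarrow>
            centralizer3 br (cayley_e eh hh fh) (cayley_h eh hh fh) (cayley_f eh hh fh)
              \<subseteq> plus_space sg \<and>
            int (vec.dim (minus_space sg)) - int (vec.dim (plus_space sg)) =
            int (vec.dim (grade_space br (cayley_h eh hh fh) 0))
              - 2 * int (vec.dim (centralizer3 br (cayley_e eh hh fh) (cayley_h eh hh fh) (cayley_f eh hh fh))))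
         \<and> (extended_magical_real br sg eh hh fh \<longrightarrow>
            (let cR = centralizer3 br (cayley_e eh hh fh) (cayley_h eh hh fh) (cayley_f eh hh fh)
                      \<inter> real_form tau
             in cR \<subseteq> plus_space sg \<inter> real_form tau \<and>
                (\<forall>x\<in>cR. x \<noteq> 0 \<longrightarrow> Im (killing br x x) = 0 \<and> Re (killing br x x) < 0)))"
proof -
  interpret real_cayley_triple br tau sg eh hh fh
    using assms by unfold_locales (simp_all add: simple_lie_algebra_def)
  have excess: "int (vec.dim (minus_space sg)) - int (vec.dim (plus_space sg)) = ad.sg_excess UNIV"
    by (simp add: ad.sg_excess_def eigen_dim_def minus_space_def plus_space_def vector_sneg_minus1[symmetric])
  have G0: "grade_space br h 0 = ad.weight_space 0"
    by (simp add: grade_space_def ad.weight_space_def)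
  have "extended_magical_real br sg eh hh fh \<longleftrightarrow>
      centralizer3 br e h f \<subseteq> plus_space sg \<and>
      int (vec.dim (minus_space sg)) - int (vec.dim (plus_space sg)) =
        int (vec.dim (grade_space br h 0)) - 2 * int (vec.dim (centralizer3 br e h f))"
    unfolding extended_magical_iff_magical ad.magical_iff_dimension_identity excess G0
      centralizer3_eq_primitive_space by (simp add: plus_space_def)
  moreover have "Im (killing br x x) = 0 \<and> Re (killing br x x) < 0"
    if "x \<in> centralizer3 br e h f" "x \<in> real_form tau" "x \<noteq> 0" "centralizer3 br e h f \<subseteq> plus_space sg" for x
    using killing_sg_negative[OF that(2,3)] that(1,4) by (auto simp: plus_space_def)
  ultimately show ?thesis by (auto simp: Let_def)
qed

end
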